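(* Let $F$ be a field, let $A \in F^{n\times n}$ and $B\in F^{n\times m}$, and let $r$ be the dimension of the span of the columns of $B, AB, \dots, A^{n-1}B$. Let $V\in F^{n\times r}$ be the compressed Krylov matrix of $B$ relatively to $A$. Let $T \in F^{n\times n}$ be any matrix obtained by completing $V$ into a basis of $F^n$ by adding $n-r$ columns at the end of $V$ (so the first $r$ columns of $T$ are those of $V$, and $T$ is non-singular). Then $T$ satisfies the definition of the Kalman form of $A$ and $B$, i.e. there exist matrices $H\in F^{r\times r}$, $X\in F^{r\times(n-r)}$, $Y\in F^{(n-r)\times(n-r)}$ and $B_1\in F^{r\times m}$ such that $$T^{-1}AT=\begin{bmatrix} H & X\\ 0 & Y\end{bmatrix},\qquad T^{-1}B=\begin{bmatrix} B_1\\ 0\end{bmatrix}.$$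
   Context: Compressed Krylov matrix: let $A\in F^{n\times n}$ and let $B\in F^{n\times m}$ have columns $b_1,\dots,b_m$. Let $K$ be the $n\times (mn)$ Krylov matrix $$K=[\,b_1\,|\,Ab_1\,|\,\cdots\,|\,A^{n-1}b_1\,|\,\cdots\,|\,b_m\,|\,Ab_m\,|\,\cdots\,|\,A^{n-1}b_m\,],$$ and let $r$ be its rank (equivalently the dimension of the span of the columns of $B,AB,\dots,A^{n-1}B$). The compressed Krylov matrix of $B$ relatively to $A$ is the $n\times r$ matrix formed by the first $r$ linearly independent columns of $K$, selected from left to right: a column of $K$ is kept if and only if it is not a linear combination of the columns of $K$ preceding it. It has the form $[\,b_1|\cdots|A^{d_1-1}b_1|\cdots|b_m|\cdots|A^{d_m-1}b_m\,]$ for some integers $d_i\ge 0$ with $\sum_{i=1}^m d_i=r$, and $(d_1,\dots,d_m)$ is the lexicographically maximal sequence for which a matrix of this form with $r$ columns has rank $r$. Kalman form: a non-singular $T\in F^{n\times n}$ satisfies the definition of the Kalman form of $(A,B)$ if $T^{-1}AT$ and $T^{-1}B$ have the block shapes displayed in the claim, with $r=\dim \mathrm{Span}(B,AB,\dots,A^{n-1}B)$. *)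

theory Defs
  imports "Jordan_Normal_Form.DL_Rank"
begin

context vec_space
begin

definition krylov_mat :: "'a mat \<Rightarrow> 'a mat \<Rightarrow> 'a mat" where
  "krylov_mat A B = mat_of_cols n
     (concat (map (\<lambda>j. map (\<lambda>k. (A ^\<^sub>m k) *\<^sub>v col B j) [0..<n]) [0..<dim_col B]))"

definition krylov_dim :: "'a mat \<Rightarrow> 'a mat \<Rightarrow> nat" where
  "krylov_dim A B = vectorspace.dim class_ring (span_vs (\<Union>k<n. set (cols ((A ^\<^sub>m k) * B))))"

text \<open>Positions matter here: a repeated column is kept at most once, and since the span of the
  empty set is the zero space, zero columns are always dropped.\<close>

definition leftmost_indpt_cols :: "'a mat \<Rightarrow> 'a vec list" where
  "leftmost_indpt_cols K =
     map (col K) (filter (\<lambda>j. col K j \<notin> span (set (take j (cols K)))) [0..<dim_col K])"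

definition compressed_krylov :: "'a mat \<Rightarrow> 'a mat \<Rightarrow> 'a mat" where
  "compressed_krylov A B = mat_of_cols n (leftmost_indpt_cols (krylov_mat A B))"

text \<open>The matrix \<open>T'\<close> is the inverse of \<open>T\<close>; its existence says that \<open>T\<close> is non-singular.\<close>

definition kalman_form :: "'a mat \<Rightarrow> 'a mat \<Rightarrow> 'a mat \<Rightarrow> bool" where
  "kalman_form A B T \<longleftrightarrow>
     (let r = krylov_dim A B; m = dim_col B in
      T \<in> carrier_mat n n \<and>
      (\<exists>T' \<in> carrier_mat n n. inverts_mat T T' \<and> inverts_mat T' T \<and>
        (\<exists>H \<in> carrier_mat r r. \<exists>X \<in> carrier_mat r (n - r). \<exists>Y \<in> carrier_mat (n - r) (n - r).
         \<exists>B\<^sub>1 \<in> carrier_mat r m.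
           T' * A * T = four_block_mat H X (0\<^sub>m (n - r) r) Y \<and>
           T' * B = B\<^sub>1 @\<^sub>r 0\<^sub>m (n - r) m)))"

lemma leftmost_indpt_cols_mat_of_cols:
  assumes "set ws \<subseteq> carrier_vec n"
  shows "distinct (leftmost_indpt_cols (mat_of_cols n ws)) \<and>
    set (leftmost_indpt_cols (mat_of_cols n ws)) \<subseteq> set ws \<and>
    lin_indpt (set (leftmost_indpt_cols (mat_of_cols n ws))) \<and>
    span (set (leftmost_indpt_cols (mat_of_cols n ws))) = span (set ws)"
  using assms
proof (induction ws rule: rev_induct)
  case Nil
  have "lin_indpt {}" by (simp add: lin_dep_def)
  then show ?case by (simp add: leftmost_indpt_cols_def)
next
  case (snoc x ws)
  define L where "L = leftmost_indpt_cols (mat_of_cols n ws)"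
  have ws: "set ws \<subseteq> carrier_vec n" and x: "x \<in> carrier_vec n" using snoc.prems by auto
  note IH = snoc.IH[OF ws, folded L_def]
  have c: "col (mat_of_cols n (ws @ [x])) j = (ws @ [x]) ! j" if "j < Suc (length ws)" for j
    using that snoc.prems by (intro col_mat_of_cols) (auto simp: nth_append less_Suc_eq)
  have c': "col (mat_of_cols n ws) j = ws ! j" if "j < length ws" for j
    using that ws by (intro col_mat_of_cols) auto
  have "leftmost_indpt_cols (mat_of_cols n (ws @ [x])) =
      map ((!) (ws @ [x])) (filter (\<lambda>j. (ws @ [x]) ! j \<notin> span (set (take j (ws @ [x])))) [0..<Suc (length ws)])"
    unfolding leftmost_indpt_cols_def cols_mat_of_cols[OF snoc.prems]
    by (intro map_cong filter_cong) (auto simp: c simp del: upt_Suc)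
  also have "\<dots> = map ((!) (ws @ [x])) (filter (\<lambda>j. (ws @ [x]) ! j \<notin> span (set (take j (ws @ [x])))) [0..<length ws])
      @ (if x \<in> span (set ws) then [] else [x])" by simp
  also have "map ((!) (ws @ [x])) (filter (\<lambda>j. (ws @ [x]) ! j \<notin> span (set (take j (ws @ [x])))) [0..<length ws]) = L"
    unfolding L_def leftmost_indpt_cols_def cols_mat_of_cols[OF ws]
    by (auto simp: c' nth_append intro!: map_cong filter_cong)
  finally have eq: "leftmost_indpt_cols (mat_of_cols n (ws @ [x])) = L @ (if x \<in> span (set ws) then [] else [x])" .
  have Lc: "set L \<subseteq> carrier_vec n" using IH ws by auto
  show ?case
  proof (cases "x \<in> span (set ws)")
    case True
    have "span (insert x (set ws)) = span (set ws)"
    proof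
      have "insert x (set ws) \<subseteq> span (set ws)" using True in_own_span[of "set ws"] ws by auto
      then show "span (insert x (set ws)) \<subseteq> span (set ws)"
        using ws by (metis span_is_subset span_is_submodule carrier_vec_dim_vec module_vec_simps(3))
      show "span (set ws) \<subseteq> span (insert x (set ws))" by (rule span_is_monotone) auto
    qed
    then show ?thesis using True IH by (auto simp: eq)
  next
    case False
    have xL: "x \<notin> span (set L)" using False IH by auto
    have xn: "x \<notin> set L" using xL in_own_span[of "set L"] Lc by auto
    have li: "lin_indpt (insert x (set L))"
      using lin_dep_iff_in_span[of "set L" x] IH Lc x xn xL by auto
    have "span (insert x (set L)) = span (insert x (set ws))"
    proof
      show "span (insert x (set L)) \<subseteq> span (insert x (set ws))"
        using IH by (intro span_is_monotone) auto
      have "set ws \<subseteq> span (set L)" using IH in_own_span[of "set ws"] ws by auto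
      also have "\<dots> \<subseteq> span (insert x (set L))" by (rule span_is_monotone) auto
      finally have "insert x (set ws) \<subseteq> span (insert x (set L))"
        using in_own_span[of "insert x (set L)"] Lc x by auto
      then show "span (insert x (set ws)) \<subseteq> span (insert x (set L))"
        using Lc x by (metis span_is_subset span_is_submodule insert_subset module_vec_simps(3))
    qed
    then show ?thesis using False IH li xn by (auto simp: eq)
  qed
qed

lemma compressed_krylov_carrier:
  assumes A: "A \<in> carrier_mat n n" and B: "B \<in> carrier_mat n m"
  shows "compressed_krylov A B \<in> carrier_mat n (krylov_dim A B)" and "krylov_dim A B \<le> n"
proof -
  define ws where "ws = concat (map (\<lambda>j. map (\<lambda>k. (A ^\<^sub>m k) *\<^sub>v col B j) [0..<n]) [0..<dim_col B])"
  define L where "L = leftmost_indpt_cols (mat_of_cols n ws)"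
  have P: "A ^\<^sub>m k \<in> carrier_mat n n" for k using A by simp
  have ws: "set ws \<subseteq> carrier_vec n" using P B unfolding ws_def
    by (auto intro!: mult_mat_vec_carrier[OF P])
  have "set ws = (\<Union>k<n. set (cols ((A ^\<^sub>m k) * B)))"
  proof -
    have "set (cols ((A ^\<^sub>m k) * B)) = (\<lambda>j. (A ^\<^sub>m k) *\<^sub>v col B j) ` {0..<dim_col B}" for k
    proof -
      have "col ((A ^\<^sub>m k) * B) j = (A ^\<^sub>m k) *\<^sub>v col B j" if "j < dim_col B" for j
        using col_mult2[OF P B] that B by auto
      then show ?thesis unfolding cols_def by (auto intro!: image_cong simp del: col_mult2)
    qed
    then show ?thesis unfolding ws_def by fastforce
  qed
  then have d: "krylov_dim A B = vectorspace.dim class_ring (span_vs (set ws))"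
    unfolding krylov_dim_def by simp
  note L = leftmost_indpt_cols_mat_of_cols[OF ws, folded L_def]
  have "maximal (set L) (\<lambda>S. S \<subseteq> set L \<and> lin_indpt S)" using L by (auto simp: maximal_def)
  then have "vectorspace.dim class_ring (span_vs (set L)) = card (set L)"
    using L ws by (intro dim_span) auto
  then have len: "krylov_dim A B = length L"
    using L unfolding d by (simp add: distinct_card)
  then show "compressed_krylov A B \<in> carrier_mat n (krylov_dim A B)"
    unfolding compressed_krylov_def krylov_mat_def L_def ws_def by simp
  show "krylov_dim A B \<le> n"
    using li_le_dim(2)[of "set L"] L ws len by (auto simp: distinct_card dim_is_n)
qed

end

end

(* The span W of the Krylov vectors is A-invariant, because A^k b lies in the span of b, ..., A^(k-1) b
   for some k <= n.  The first r columns of T span W, so in the coordinates given by T the space W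
   consists of the vectors that vanish from position r on. *)

theory Submission
  imports Defs
begin

text \<open>By definition \<open>A ^\<^sub>m Suc k\<close> puts the new factor on the right. Passing
  to the next Krylov vector needs it on the left, so the induction generalises over \<open>b\<close>
  and absorbs the right factor into \<open>A *\<^sub>v b\<close>.\<close>

lemma pow_mat_Suc_mult_vec:
  assumes A: "(A :: 'a::comm_semiring_1 mat) \<in> carrier_mat n n" and b: "b \<in> carrier_vec n"
  shows "(A ^\<^sub>m Suc k) *\<^sub>v b = A *\<^sub>v ((A ^\<^sub>m k) *\<^sub>v b)"
  using b
proof (induction k arbitrary: b)
  case 0
  then show ?case using A by simp
next
  case (Suc k)
  have P: "A ^\<^sub>m k \<in> carrier_mat n n" for k using A by simp
  have Ab: "A *\<^sub>v b \<in> carrier_vec n" using A Suc.prems by simp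
  have "(A ^\<^sub>m Suc (Suc k)) *\<^sub>v b = (A ^\<^sub>m Suc k) *\<^sub>v (A *\<^sub>v b)"
    using assoc_mult_mat_vec[OF P[of "Suc k"] A Suc.prems] by simp
  also have "\<dots> = A *\<^sub>v ((A ^\<^sub>m k) *\<^sub>v (A *\<^sub>v b))" by (rule Suc.IH[OF Ab])
  also have "(A ^\<^sub>m k) *\<^sub>v (A *\<^sub>v b) = (A ^\<^sub>m Suc k) *\<^sub>v b"
    using assoc_mult_mat_vec[OF P[of k] A Suc.prems] by simp
  finally show ?case .
qed

text \<open>Turns entrywise vanishing into the existential block shape that
  \<open>kalman_form\<close> asks for; the blocks are cut out of \<open>M\<close> itself.\<close>

lemma four_block_mat_lower_left_zero:
  assumes M: "M \<in> carrier_mat n n" and r: "r \<le> n"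
    and zero: "\<And>i j. r \<le> i \<Longrightarrow> i < n \<Longrightarrow> j < r \<Longrightarrow> M $$ (i, j) = 0"
  obtains H X Y where "H \<in> carrier_mat r r" "X \<in> carrier_mat r (n - r)"
    "Y \<in> carrier_mat (n - r) (n - r)" "M = four_block_mat H X (0\<^sub>m (n - r) r) Y"
proof
  let ?H = "mat r r (\<lambda>(i, j). M $$ (i, j))"
  let ?X = "mat r (n - r) (\<lambda>(i, j). M $$ (i, j + r))"
  let ?Y = "mat (n - r) (n - r) (\<lambda>(i, j). M $$ (i + r, j + r))"
  show "M = four_block_mat ?H ?X (0\<^sub>m (n - r) r) ?Y"
    using M r zero by (intro eq_matI) auto
qed auto

lemma append_rows_zero:
  assumes M: "M \<in> carrier_mat n m" and r: "r \<le> n"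
    and zero: "\<And>i j. r \<le> i \<Longrightarrow> i < n \<Longrightarrow> j < m \<Longrightarrow> M $$ (i, j) = 0"
  obtains U where "U \<in> carrier_mat r m" "M = U @\<^sub>r 0\<^sub>m (n - r) m"
proof
  let ?U = "mat r m (\<lambda>(i, j). M $$ (i, j))"
  show "M = ?U @\<^sub>r 0\<^sub>m (n - r) m"
    using M r zero unfolding append_rows_def by (intro eq_matI) auto
qed auto

context vec_space
begin

lemma submodule_mult_mat_vec_vimage:
  assumes M: "M \<in> carrier_mat n n" and W: "submodule class_ring W V"
  shows "submodule class_ring {v \<in> carrier_vec n. M *\<^sub>v v \<in> W} V"
proof -
  have "M *\<^sub>v 0\<^sub>v n = 0\<^sub>v n" using M by (intro eq_vecI) auto
  then show ?thesis using M W unfolding submodule_def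
    by (auto simp: module_vec_simps class_ring_simps mult_add_distrib_mat_vec mult_mat_vec)
qed

text \<open>The preimage of \<open>W\<close> under \<open>M\<close> is a subspace containing
  \<open>S\<close>, hence containing \<open>span S\<close>. Every later claim about a span is
  thereby reduced to its generators.\<close>

lemma mult_mat_vec_span:
  assumes M: "M \<in> carrier_mat n n" and W: "submodule class_ring W V"
    and S: "S \<subseteq> carrier_vec n" "\<And>v. v \<in> S \<Longrightarrow> M *\<^sub>v v \<in> W"
    and v: "v \<in> span S"
  shows "M *\<^sub>v v \<in> W"
  using span_is_subset[OF _ submodule_mult_mat_vec_vimage[OF M W], of S] S v by auto

text \<open>Serves with \<open>I = {r..}\<close> as the description of the Krylov space in the
  coordinates given by \<open>T\<close>. The guard \<open>i < n\<close> keeps unspecified entries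
  \<open>v $ i\<close> out of the condition, so that \<open>I\<close> may be unbounded.\<close>

lemma submodule_zero_coords:
  "submodule class_ring {v \<in> carrier_vec n. \<forall>i\<in>I. i < n \<longrightarrow> v $ i = 0} V"
  using module_axioms unfolding submodule_def
  by (auto simp: module_vec_simps class_ring_simps)

text \<open>Otherwise the vectors \<open>A^0 b\<close>, ..., \<open>A^n b\<close> would be
  \<open>n + 1\<close> linearly independent vectors in a space of dimension
  \<open>n\<close>.\<close>

lemma krylov_vec_in_span_previous:
  assumes A: "A \<in> carrier_mat n n" and b: "b \<in> carrier_vec n"
  obtains k where "k \<le> n" "(A ^\<^sub>m k) *\<^sub>v b \<in> span ((\<lambda>i. (A ^\<^sub>m i) *\<^sub>v b) ` {..<k})"
proof (rule ccontr)
  define f where "f i = (A ^\<^sub>m i) *\<^sub>v b" for i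
  have f: "f i \<in> carrier_vec n" for i using A b by (simp add: f_def mult_mat_vec_carrier[of _ n n])
  assume "\<not> thesis"
  with that have no: "f k \<notin> span (f ` {..<k})" if "k \<le> n" for k
    using \<open>k \<le> n\<close> unfolding f_def by blast
  \<comment> \<open>Independence of the image set alone would not exclude repetitions among the
    \<open>f i\<close>, so the cardinality is carried through the induction.\<close>
  have "lin_indpt (f ` {..<k}) \<and> card (f ` {..<k}) = k" if "k \<le> Suc n" for k
    using that
  proof (induction k)
    case 0
    then show ?case by (simp add: lin_dep_def)
  next
    case (Suc k)
    have S: "f ` {..<k} \<subseteq> carrier_vec n" using f by auto
    have new: "f k \<notin> f ` {..<k}" using no[of k] Suc.prems in_own_span[OF S] by auto
    then have "lin_indpt (insert (f k) (f ` {..<k}))"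
      using lin_dep_iff_in_span[OF S _ f new] no[of k] Suc by auto
    then show ?case using Suc new by (simp add: lessThan_Suc)
  qed
  from this[of "Suc n"] have "Suc n \<le> dim"
    using li_le_dim(2)[OF fin_dim, of "f ` {..<Suc n}"] f by auto
  then show False by (simp add: dim_is_n)
qed

text \<open>A consequence of Cayley-Hamilton, obtained here by dimension counting: once
  \<open>A^k b\<close> lies in the span of its predecessors, that span is invariant under
  \<open>A\<close> and so contains all powers applied to \<open>b\<close>.\<close>

lemma krylov_vec_in_span:
  assumes A: "A \<in> carrier_mat n n" and b: "b \<in> carrier_vec n"
  shows "(A ^\<^sub>m j) *\<^sub>v b \<in> span ((\<lambda>i. (A ^\<^sub>m i) *\<^sub>v b) ` {..<n})"
proof -
  define f where "f i = (A ^\<^sub>m i) *\<^sub>v b" for i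
  have f: "f i \<in> carrier_vec n" for i using A b by (simp add: f_def mult_mat_vec_carrier[of _ n n])
  have Suc_f: "f (Suc i) = A *\<^sub>v f i" for i
    unfolding f_def by (rule pow_mat_Suc_mult_vec[OF A b])
  obtain k where k: "k \<le> n" "f k \<in> span (f ` {..<k})"
    using krylov_vec_in_span_previous[OF A b] unfolding f_def by blast
  let ?S = "f ` {..<k}"
  have S: "?S \<subseteq> carrier_vec n" using f by auto
  have le: "f i \<in> span ?S" if "i \<le> k" for i
    using that k in_own_span[OF S] by (cases "i = k") auto
  have "f j \<in> span ?S"
  proof (induction j)
    case 0
    show ?case by (rule le) simp
  next
    case (Suc j)
    \<comment> \<open>Here \<open>v = f i\<close> with \<open>i < k\<close>, so \<open>A\<close>
      sends it to \<open>f (Suc i)\<close> with \<open>Suc i \<le> k\<close>; the boundary case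
      \<open>Suc i = k\<close> is the choice of \<open>k\<close>.\<close>
    have "A *\<^sub>v v \<in> span ?S" if "v \<in> ?S" for v
      using that le by (auto simp flip: Suc_f)
    then show ?case unfolding Suc_f
      using Suc by (rule mult_mat_vec_span[OF A span_is_submodule[OF S] S])
  qed
  also have "span ?S \<subseteq> span (f ` {..<n})" using k by (intro span_is_monotone) auto
  finally show ?thesis unfolding f_def .
qed

lemma cols_krylov_mat:
  assumes A: "A \<in> carrier_mat n n" and B: "B \<in> carrier_mat n m"
  shows "set (cols (krylov_mat A B)) = (\<Union>j<m. (\<lambda>k. (A ^\<^sub>m k) *\<^sub>v col B j) ` {..<n})"
proof -
  have c: "(A ^\<^sub>m k) *\<^sub>v col B j \<in> carrier_vec n" for j k
    using A B by (intro mult_mat_vec_carrier[of _ n n]) auto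
  show ?thesis using B c unfolding krylov_mat_def
    by (subst cols_mat_of_cols) auto
qed

text \<open>Multiplication by \<open>A\<close> moves a Krylov column to the next one in its block.
  Only the power \<open>n\<close> falls outside the list, and \<open>krylov_vec_in_span\<close>
  brings it back into the span.\<close>

lemma krylov_mat_invariant:
  assumes A: "A \<in> carrier_mat n n" and B: "B \<in> carrier_mat n m"
    and v: "v \<in> span (set (cols (krylov_mat A B)))"
  shows "A *\<^sub>v v \<in> span (set (cols (krylov_mat A B)))"
proof -
  let ?S = "set (cols (krylov_mat A B))"
  have S: "?S \<subseteq> carrier_vec n"
    using cols_dim[of "krylov_mat A B"] by (simp add: krylov_mat_def)
  have "A *\<^sub>v w \<in> span ?S" if w: "w \<in> ?S" for w
  proof -
    obtain j k where j: "j < m" and w_eq: "w = (A ^\<^sub>m k) *\<^sub>v col B j"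
      using w unfolding cols_krylov_mat[OF A B] by auto
    have b: "col B j \<in> carrier_vec n" using B by auto
    have "A *\<^sub>v w \<in> span ((\<lambda>i. (A ^\<^sub>m i) *\<^sub>v col B j) ` {..<n})"
      unfolding w_eq pow_mat_Suc_mult_vec[OF A b, symmetric] by (rule krylov_vec_in_span[OF A b])
    also have "\<dots> \<subseteq> span ?S"
      unfolding cols_krylov_mat[OF A B] using j by (intro span_is_monotone) auto
    finally show ?thesis .
  qed
  then show ?thesis using v by (rule mult_mat_vec_span[OF A span_is_submodule[OF S] S])
qed

lemma col_in_span_krylov_mat:
  assumes A: "A \<in> carrier_mat n n" and B: "B \<in> carrier_mat n m" and j: "j < m"
  shows "col B j \<in> span (set (cols (krylov_mat A B)))"
proof -
  have b: "col B j \<in> carrier_vec n" using B by auto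
  \<comment> \<open>For \<open>n > 0\<close> the vector is itself the generator with exponent 0.
    Going through \<open>krylov_vec_in_span\<close> also covers \<open>n = 0\<close>, where there
    are no generators.\<close>
  have "col B j \<in> span ((\<lambda>i. (A ^\<^sub>m i) *\<^sub>v col B j) ` {..<n})"
    using krylov_vec_in_span[OF A b, of 0] A b by simp
  also have "\<dots> \<subseteq> span (set (cols (krylov_mat A B)))"
    unfolding cols_krylov_mat[OF A B] using j by (intro span_is_monotone) auto
  finally show ?thesis .
qed

lemma span_cols_compressed_krylov:
  "span (set (cols (compressed_krylov A B))) = span (set (cols (krylov_mat A B)))"
proof -
  let ?K = "krylov_mat A B"
  have K: "set (cols ?K) \<subseteq> carrier_vec n"
    using cols_dim[of ?K] by (simp add: krylov_mat_def)
  \<comment> \<open>The selection lemma speaks of \<open>mat_of_cols n ws\<close>, so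
    \<open>?K\<close> is rewritten as the matrix of its own columns.\<close>
  have "dim_row ?K = n" by (simp add: krylov_mat_def)
  then have "mat_of_cols n (cols ?K) = ?K" by (metis mat_of_cols_cols)
  then have L: "set (leftmost_indpt_cols ?K) \<subseteq> set (cols ?K)"
    "span (set (leftmost_indpt_cols ?K)) = span (set (cols ?K))"
    using leftmost_indpt_cols_mat_of_cols[OF K] by auto
  then show ?thesis using K unfolding compressed_krylov_def by (subst cols_mat_of_cols) auto
qed

lemma kalman_form_of_compressed_krylov:
  assumes A: "A \<in> carrier_mat n n" and B: "B \<in> carrier_mat n m"
    and T: "T \<in> carrier_mat n n" "invertible_mat T"
    and col_T: "\<And>j. j < krylov_dim A B \<Longrightarrow> col T j = col (compressed_krylov A B) j"
  shows "kalman_form A B T"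
proof -
  define r where "r = krylov_dim A B"
  let ?C = "compressed_krylov A B"
  define W where "W = span (set (cols (krylov_mat A B)))"
  have C: "?C \<in> carrier_mat n r" and r: "r \<le> n"
    using compressed_krylov_carrier[OF A B] by (simp_all add: r_def)
  have colsC: "set (cols ?C) \<subseteq> carrier_vec n" using C cols_dim[of ?C] by simp
  have W: "W = span (set (cols ?C))" unfolding W_def span_cols_compressed_krylov ..
  obtain T' where inv: "inverts_mat T T'" "inverts_mat T' T"
    using T unfolding invertible_mat_def by blast
  have TT': "T * T' = 1\<^sub>m n" using inv T by (simp add: inverts_mat_def)
  have T'T: "T' * T = 1\<^sub>m (dim_row T')" using inv by (simp add: inverts_mat_def)
  \<comment> \<open>\<open>invertible_mat\<close> does not state the dimensions of the inverse; they
    are read off from the two products.\<close>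
  have "dim_col T' = n" using arg_cong[OF TT', of dim_col] by simp
  moreover have "dim_row T' = n" using arg_cong[OF T'T, of dim_col] T by simp
  ultimately have T': "T' \<in> carrier_mat n n" by auto
  \<comment> \<open>It suffices to test the columns of \<open>?C\<close>, which span
    \<open>W\<close>. Each is a column \<open>j < r\<close> of \<open>T\<close>, so
    \<open>T'\<close> sends it to the unit vector \<open>j\<close>, which vanishes from position
    \<open>r\<close> on.\<close>
  have T'_W: "(T' *\<^sub>v v) $ i = 0" if "v \<in> W" "r \<le> i" "i < n" for v i
  proof -
    let ?Z = "{v \<in> carrier_vec n. \<forall>i\<in>{r..}. i < n \<longrightarrow> v $ i = 0}"
    have "T' *\<^sub>v c \<in> ?Z" if c: "c \<in> set (cols ?C)" for c
    proof -
      obtain j where j: "j < r" "c = col T j"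
        using c C col_T by (auto simp: cols_def r_def)
      have "T' *\<^sub>v c = col (1\<^sub>m n) j"
        using col_mult2[OF T' T(1), of j] j r T'T T' by simp
      then show ?thesis using j r by auto
    qed
    then have "T' *\<^sub>v v \<in> ?Z"
      using \<open>v \<in> W\<close> unfolding W
      by (rule mult_mat_vec_span[OF T' submodule_zero_coords colsC])
    then show ?thesis using that by auto
  qed
  have AT: "A * T \<in> carrier_mat n n" using A T by simp
  have TAT: "T' * A * T \<in> carrier_mat n n" using T' A T by simp
  have assoc: "T' * A * T = T' * (A * T)" using T' A T by simp
  \<comment> \<open>Column \<open>j\<close> of \<open>T' * A * T\<close> is \<open>T'\<close>
    applied to \<open>A *\<^sub>v col T j\<close>. For \<open>j < r\<close> the column of
    \<open>T\<close> lies in \<open>W\<close>, and invariance keeps its image there.\<close>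
  have lower_left: "(T' * A * T) $$ (i, j) = 0" if "r \<le> i" "i < n" "j < r" for i j
  proof -
    have jn: "j < n" using that r by simp
    have "col T j \<in> set (cols ?C)" using that col_T[of j] C by (auto simp: cols_def r_def)
    then have "col T j \<in> W" unfolding W using in_own_span[OF colsC] by auto
    then have "A *\<^sub>v col T j \<in> W" unfolding W_def by (rule krylov_mat_invariant[OF A B])
    then have "(T' *\<^sub>v (A *\<^sub>v col T j)) $ i = 0" using that by (intro T'_W)
    moreover have "T' *\<^sub>v (A *\<^sub>v col T j) = col (T' * (A * T)) j"
      unfolding col_mult2[OF T' AT jn] col_mult2[OF A T(1) jn] ..
    moreover have "col (T' * (A * T)) j $ i = (T' * (A * T)) $$ (i, j)"
      using that jn T' AT by (intro index_col) auto
    ultimately show ?thesis unfolding assoc by simp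
  qed
  obtain H X Y where HXY: "H \<in> carrier_mat r r" "X \<in> carrier_mat r (n - r)"
    "Y \<in> carrier_mat (n - r) (n - r)" "T' * A * T = four_block_mat H X (0\<^sub>m (n - r) r) Y"
    by (rule four_block_mat_lower_left_zero[OF TAT r lower_left])
  have TB: "T' * B \<in> carrier_mat n m" using T' B by simp
  \<comment> \<open>No invariance is involved here: the columns of \<open>B\<close> themselves lie
    in \<open>W\<close>.\<close>
  have bottom: "(T' * B) $$ (i, j) = 0" if "r \<le> i" "i < n" "j < m" for i j
  proof -
    have "(T' *\<^sub>v col B j) $ i = 0"
      using that col_in_span_krylov_mat[OF A B] by (intro T'_W) (auto simp: W_def)
    then show ?thesis using that T' B by simp
  qed
  obtain U where "U \<in> carrier_mat r m" "T' * B = U @\<^sub>r 0\<^sub>m (n - r) m"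
    by (rule append_rows_zero[OF TB r bottom])
  then show ?thesis
    unfolding kalman_form_def Let_def r_def[symmetric] using T T' inv HXY B by auto
qed

end

theorem theorem4p2:
  fixes A B V T :: "'a::field mat" and n m r :: nat
  assumes "A \<in> carrier_mat n n" and "B \<in> carrier_mat n m"
    and "r = vec_space.krylov_dim n A B"
    and "V = vec_space.compressed_krylov n A B"
    and "T \<in> carrier_mat n n" and "invertible_mat T"
    and "\<And>j. j < r \<Longrightarrow> col T j = col V j"
  shows "vec_space.kalman_form n A B T"
  using assms by (intro vec_space.kalman_form_of_compressed_krylov) auto

end
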